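(* Let $m,n\ge1$, $N=\min(m,n)$, $1\le K<N$, $\rho>0$, and let $F=U_F\Sigma_\phi V_F^*$ be a singular value decomposition of a given complex $m\times n$ matrix, with singular values $\phi_1\ge\dots\ge\phi_N\ge0$. Let $\mathcal I(A)=\mathcal R_K(A)+\|A-F\|^2$ and let $\mathcal I^{**}$ be its convex envelope. If $$\phi_K\ge(1+\rho)\phi_{K+1},$$ then the solution of $\operatorname{argmin}_A\ \mathcal I^{**}(A)+\rho\|A-F\|^2$ is $A=U_F\Sigma_{\tilde\phi}V_F^*$, where $\tilde\phi_j=\phi_j$ for $1\le j\le K$ and $\tilde\phi_j=0$ for $j>K$.
   Context: $\|\cdot\|$ is the Frobenius norm on complex $m\times n$ matrices, and the space is regarded as a real Hilbert space with $\langle A,B\rangle=\operatorname{Re}\operatorname{tr}(B^*A)$. $\mathcal R_K(A)=0$ if $\operatorname{rank}A\le K$ and $\mathcal R_K(A)=+\infty$ otherwise. The convex envelope $\mathcal I^{**}$ of $\mathcal I$ is the largest convex function that is pointwise $\le\mathcal I$; it equals the Fenchel bi-conjugate of $\mathcal I$, where $f^*(B)=\sup_A(\langle A,B\rangle-f(A))$. For a sequence $\alpha=(\alpha_j)_{j=1}^N$, $\Sigma_\alpha$ is the $N\times N$ diagonal matrix with diagonal entries $\alpha_1,\dots,\alpha_N$. A singular value decomposition $F=U_F\Sigma_\phi V_F^*$ has $U_F\in\mathbb C^{m\times N}$, $V_F\in\mathbb C^{n\times N}$, $U_F^*U_F=V_F^*V_F=I_N$, and $\phi$ the nonincreasing sequence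 of singular values of $F$. *)

theory Defs
  imports "HOL-Analysis.Analysis"
begin

section \<open>Matrices\<close>

text \<open>
  Complex \<open>m \<times> n\<close> matrices are elements of \<open>complex^'n^'m\<close>.  As the lemmas below show, the
  library norm and (real) inner product of that type are the Frobenius norm and
  \<open>Re tr(B\<^sup>* A)\<close>.
\<close>

definition conj_transpose :: "complex^'n^'m \<Rightarrow> complex^'m^'n"
  where "conj_transpose A = map_matrix cnj (transpose A)"

lemma norm_eq_Frobenius:
  fixes A :: "complex^'n^'m"
  shows "norm A = sqrt (\<Sum>i\<in>UNIV. \<Sum>j\<in>UNIV. (cmod (A $ i $ j))\<^sup>2)"
  by (simp add: norm_vec_def L2_set_def sum_nonneg)

lemma inner_eq_Re_trace:
  fixes A B :: "complex^'n^'m"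
  shows "A \<bullet> B = Re (trace (conj_transpose B ** A))"
proof -
  have "A \<bullet> B = (\<Sum>i\<in>UNIV. \<Sum>j\<in>UNIV. Re (cnj (B $ i $ j) * A $ i $ j))"
    by (simp add: inner_vec_def inner_complex_def mult.commute)
  also have "\<dots> = (\<Sum>j\<in>UNIV. \<Sum>i\<in>UNIV. Re (cnj (B $ i $ j) * A $ i $ j))"
    by (rule sum.swap)
  also have "\<dots> = Re (trace (conj_transpose B ** A))"
    by (simp add: trace_def conj_transpose_def transpose_def matrix_matrix_mult_def)
  finally show ?thesis .
qed

text \<open>
  The \<open>N = min m n\<close> columns of \<open>U\<close> and \<open>V\<close> are indexed by a finite type \<open>'k\<close>; a bijection \<open>idx\<close> from
  \<open>'k\<close> onto \<open>{1..N}\<close> numbers them, so that sequences \<open>\<alpha>\<^sub>1, \<dots>, \<alpha>\<^sub>N\<close> are functions on \<open>nat\<close>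
  of which only the values on \<open>{1..N}\<close> matter.
\<close>

definition diag_matrix :: "('k \<Rightarrow> nat) \<Rightarrow> (nat \<Rightarrow> real) \<Rightarrow> complex^'k^'k"
  where "diag_matrix idx \<alpha> = (\<chi> i j. if i = j then complex_of_real (\<alpha> (idx i)) else 0)"

definition is_svd ::
  "('k \<Rightarrow> nat) \<Rightarrow> complex^'n^'m \<Rightarrow> complex^'k^'m \<Rightarrow> (nat \<Rightarrow> real) \<Rightarrow> complex^'k^'n \<Rightarrow> bool"
  where "is_svd idx F U \<phi> V \<longleftrightarrow> (let N = min CARD('m) CARD('n) in
    bij_betw idx (UNIV :: 'k set) {1..N} \<and>
    conj_transpose U ** U = mat 1 \<and> conj_transpose V ** V = mat 1 \<and>
    (\<forall>i\<in>{1..N}. \<forall>j\<in>{1..N}. i \<le> j \<longrightarrow> \<phi> j \<le> \<phi> i) \<and> (\<forall>j\<in>{1..N}. 0 \<le> \<phi> j) \<and>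
    F = U ** diag_matrix idx \<phi> ** conj_transpose V)"


section \<open>Convex envelopes of extended-valued functions\<close>

text \<open>
  Convexity through the epigraph avoids \<open>\<infinity> - \<infinity>\<close>; for functions that omit the value \<open>-\<infinity>\<close>
  it is the usual inequality.
\<close>

definition convex_ereal :: "('a::real_vector \<Rightarrow> ereal) \<Rightarrow> bool"
  where "convex_ereal f \<longleftrightarrow> convex {(x, r :: real). f x \<le> ereal r}"

definition convex_envelope :: "('a::real_vector \<Rightarrow> ereal) \<Rightarrow> 'a \<Rightarrow> ereal"
  where "convex_envelope f x = (SUP g \<in> {g. convex_ereal g \<and> (\<forall>y. g y \<le> f y)}. g x)"

lemma convex_ereal_iff:
  assumes "\<And>x. f x \<noteq> - \<infinity>"
  shows "convex_ereal f \<longleftrightarrow>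
    (\<forall>x y u v. 0 \<le> u \<longrightarrow> 0 \<le> v \<longrightarrow> u + v = 1 \<longrightarrow>
       f (u *\<^sub>R x + v *\<^sub>R y) \<le> ereal u * f x + ereal v * f y)"
    (is "_ \<longleftrightarrow> ?R")
proof
  assume L: "convex_ereal f"
  show ?R
  proof (intro allI impI)
    fix x y and u v :: real
    assume uv: "0 \<le> u" "0 \<le> v" "u + v = 1"
    show "f (u *\<^sub>R x + v *\<^sub>R y) \<le> ereal u * f x + ereal v * f y"
    proof (cases "u = 0 \<or> v = 0")
      case True
      then show ?thesis using uv by (auto simp flip: zero_ereal_def)
    next
      case False
      then have pos: "u > 0" "v > 0" using uv by auto
      show ?thesis
      proof (cases "f x = \<infinity> \<or> f y = \<infinity>")
        case True
        then show ?thesis using pos assms[of x] assms[of y]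
          by (cases "f x"; cases "f y") auto
      next
        case False
        then obtain a b where ab: "f x = ereal a" "f y = ereal b"
          using assms[of x] assms[of y] by (cases "f x"; cases "f y") auto
        have "u *\<^sub>R (x, a) + v *\<^sub>R (y, b) \<in> {(x, r :: real). f x \<le> ereal r}"
          using L uv ab unfolding convex_ereal_def by (intro convexD) auto
        then show ?thesis by (simp add: ab)
      qed
    qed
  qed
next
  assume R: ?R
  show "convex_ereal f"
    unfolding convex_ereal_def
  proof (rule convexI, clarsimp)
    fix x y a b and u v :: real
    assume h: "f x \<le> ereal a" "f y \<le> ereal b" and uv: "0 \<le> u" "0 \<le> v" "u + v = 1"
    have "f (u *\<^sub>R x + v *\<^sub>R y) \<le> ereal u * f x + ereal v * f y" using R uv by blast
    also have "\<dots> \<le> ereal u * ereal a + ereal v * ereal b"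
      using h uv by (intro add_mono ereal_mult_left_mono) auto
    finally show "f (u *\<^sub>R x + v *\<^sub>R y) \<le> ereal (u * a + v * b)" by simp
  qed
qed

lemma convex_envelope_le: "convex_envelope f x \<le> f x"
  unfolding convex_envelope_def by (rule SUP_least) auto

lemma convex_ereal_envelope: "convex_ereal (convex_envelope f)"
proof -
  have "{(x, r :: real). convex_envelope f x \<le> ereal r} =
      (\<Inter>g\<in>{g. convex_ereal g \<and> (\<forall>y. g y \<le> f y)}. {(x, r). g x \<le> ereal r})"
    by (auto simp: convex_envelope_def SUP_le_iff)
  then show ?thesis
    unfolding convex_ereal_def[of "convex_envelope f"]
    by (simp only:) (rule convex_INT, auto simp: convex_ereal_def)
qed

lemma convex_envelope_greatest:
  assumes "convex_ereal g" "\<And>y. g y \<le> f y"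
  shows "g x \<le> convex_envelope f x"
  unfolding convex_envelope_def using assms by (intro SUP_upper) auto


section \<open>The functionals\<close>

definition rank_penalty :: "nat \<Rightarrow> complex^'n^'m \<Rightarrow> ereal"
  where "rank_penalty K A = (if rank A \<le> K then 0 else \<infinity>)"

definition penalized_fit :: "nat \<Rightarrow> complex^'n^'m \<Rightarrow> complex^'n^'m \<Rightarrow> ereal"
  where "penalized_fit K F A = rank_penalty K A + ereal ((norm (A - F))\<^sup>2)"

end

theory Submission
  imports Defs
begin

text \<open>
  Write \<open>A\<^sub>0\<close> for the truncation of \<open>F\<close> to its first \<open>K\<close> singular values.  The objective is a
  convex envelope plus a smooth quadratic whose gradient at \<open>A\<^sub>0\<close> is \<open>- 2 \<rho> (F - A\<^sub>0)\<close>, so \<open>A\<^sub>0\<close>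
  is optimal as soon as \<open>2 \<rho> (F - A\<^sub>0)\<close> is a subgradient of the envelope at \<open>A\<^sub>0\<close>.  An affine
  function lies below the envelope as soon as it lies below the function itself, hence no
  formula for the envelope is needed: it is enough that, for all \<open>A\<close> of rank at most \<open>K\<close>,
  \<open>\<parallel>A - F\<parallel>\<^sup>2 \<ge> \<parallel>A\<^sub>0 - F\<parallel>\<^sup>2 + 2 \<rho> \<langle>F - A\<^sub>0, A - A\<^sub>0\<rangle>\<close>.
  Completing the square, this says that \<open>A\<^sub>0\<close> is a best approximation of rank at most \<open>K\<close> to
  \<open>G = F + \<rho> (F - A\<^sub>0)\<close>.  The matrix \<open>G\<close> has the singular vectors of \<open>F\<close>, with the values
  \<open>\<phi>\<^sub>j\<close> for \<open>j \<le> K\<close> and \<open>(1 + \<rho>) \<phi>\<^sub>j\<close> for \<open>j > K\<close>; the hypothesis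
  \<open>(1 + \<rho>) \<phi>\<^bsub>K+1\<^esub> \<le> \<phi>\<^sub>K\<close> says exactly that the first group still dominates the second, so that
  \<open>A\<^sub>0\<close> is the truncation of \<open>G\<close> and the Eckart--Young theorem applies (\<open>Eckart_Young\<close>).
  Uniqueness comes from the quadratic, which leaves an excess of at least \<open>\<rho> \<parallel>A - A\<^sub>0\<parallel>\<^sup>2\<close>
  (\<open>argmin_envelope_plus_quadratic\<close>).

  The Eckart--Young theorem is proved by projecting the rows of \<open>G\<close> onto the row space of \<open>A\<close>:
  the projection captures of each \<open>\<gamma>\<^sub>j\<^sup>2\<close> a fraction between 0 and 1, these fractions add up to at
  most the rank, and the best use of such a budget is to capture the \<open>K\<close> largest values in full.
  The inner product on complex vectors being real, the row space is treated as a real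
  subspace of twice the dimension; as it is closed under multiplication by \<open>\<i>\<close>, summing an
  estimate for \<open>x\<close> and for \<open>\<i> x\<close> recovers the hermitian products.
\<close>

section \<open>Orthonormal sets in real inner product spaces\<close>

lemma orthonormal_residual:
  fixes E :: "'a::real_inner set"
  assumes fin: "finite E" and orth: "pairwise orthogonal E" and unit: "\<And>e. e \<in> E \<Longrightarrow> norm e = 1"
  defines "p \<equiv> \<lambda>x. \<Sum>e\<in>E. (x \<bullet> e) *\<^sub>R e"
  shows "z \<in> span E \<Longrightarrow> (x - p x) \<bullet> z = 0"
    and "(norm (x - p x))\<^sup>2 = (norm x)\<^sup>2 - (\<Sum>e\<in>E. (x \<bullet> e)\<^sup>2)"
proof -
  have gen: "(x - p x) \<bullet> e = 0" if "e \<in> E" for e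
  proof -
    have "p x \<bullet> e = (\<Sum>e'\<in>E. if e' = e then x \<bullet> e else 0)"
      unfolding p_def inner_sum_left
    proof (rule sum.cong[OF refl])
      fix e' assume "e' \<in> E"
      then show "(x \<bullet> e') *\<^sub>R e' \<bullet> e = (if e' = e then x \<bullet> e else 0)"
        using orth unit \<open>e \<in> E\<close> by (auto simp: pairwise_def orthogonal_def norm_eq_1)
    qed
    then show ?thesis using fin that by (simp add: inner_diff_left)
  qed
  show orthspan: "(x - p x) \<bullet> z = 0" if "z \<in> span E" for z
    using that by (induction rule: span_induct_alt) (auto simp: inner_add_right gen)
  have "p x \<in> span E"
    unfolding p_def by (intro span_sum span_scale span_base)
  then have "(x - p x) \<bullet> p x = 0" by (rule orthspan)
  then have "(norm (x - p x))\<^sup>2 = x \<bullet> x - x \<bullet> p x"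
    by (simp add: power2_norm_eq_inner inner_diff_left inner_diff_right inner_commute)
  also have "x \<bullet> p x = (\<Sum>e\<in>E. (x \<bullet> e)\<^sup>2)"
    by (simp add: p_def inner_sum_right power2_eq_square)
  finally show "(norm (x - p x))\<^sup>2 = (norm x)\<^sup>2 - (\<Sum>e\<in>E. (x \<bullet> e)\<^sup>2)"
    by (simp add: power2_norm_eq_inner)
qed

lemma Bessel_inequality:
  fixes E :: "'a::real_inner set"
  assumes "finite E" "pairwise orthogonal E" "\<And>e. e \<in> E \<Longrightarrow> norm e = 1"
  shows "(\<Sum>e\<in>E. (x \<bullet> e)\<^sup>2) \<le> (norm x)\<^sup>2"
  using orthonormal_residual(2)[OF assms, of x] zero_le_power2[of "norm (x - (\<Sum>e\<in>E. (x \<bullet> e) *\<^sub>R e))"]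
  by linarith

lemma norm_diff_span_ge:
  fixes E :: "'a::real_inner set"
  assumes E: "finite E" "pairwise orthogonal E" "\<And>e. e \<in> E \<Longrightarrow> norm e = 1"
    and a: "a \<in> span E"
  shows "(norm x)\<^sup>2 - (\<Sum>e\<in>E. (x \<bullet> e)\<^sup>2) \<le> (norm (a - x))\<^sup>2"
proof -
  define p where "p = (\<Sum>e\<in>E. (x \<bullet> e) *\<^sub>R e)"
  have "p - a \<in> span E"
    unfolding p_def by (intro span_diff a span_sum span_scale span_base)
  then have "(x - p) \<bullet> (p - a) = 0"
    unfolding p_def using E by (intro orthonormal_residual(1)) auto
  then have "(norm ((x - p) + (p - a)))\<^sup>2 = (norm (x - p))\<^sup>2 + (norm (p - a))\<^sup>2"
    by (intro norm_add_Pythagorean) (simp add: orthogonal_def)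
  then show ?thesis
    using orthonormal_residual(2)[OF E, of x] by (simp add: p_def norm_minus_commute)
qed

section \<open>Complex vectors and matrices\<close>

lemma norm_imaginary_smult: "norm (\<i> *s (x :: complex^'n)) = norm x"
  by (simp add: norm_vec_def norm_mult)

lemma inner_eq_Re_hermitian_product:
  fixes x y :: "complex^'n"
  shows "x \<bullet> y = Re (\<Sum>i\<in>UNIV. x $ i * cnj (y $ i))"
  by (simp add: inner_vec_def inner_complex_def)

text \<open>
  The bridge between the two inner products: \<open>x \<bullet> e\<close> and \<open>(\<i> x) \<bullet> e\<close> are, up to sign, the real
  and the imaginary part of the hermitian product.
\<close>

lemma cmod_hermitian_product:
  fixes x e :: "complex^'n"
  shows "(cmod (\<Sum>i\<in>UNIV. x $ i * cnj (e $ i)))\<^sup>2 = (x \<bullet> e)\<^sup>2 + ((\<i> *s x) \<bullet> e)\<^sup>2"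
proof -
  have "Re (\<Sum>i\<in>UNIV. x $ i * cnj (e $ i)) = x \<bullet> e"
    by (simp add: inner_eq_Re_hermitian_product)
  moreover have "Im (\<Sum>i\<in>UNIV. x $ i * cnj (e $ i)) = - ((\<i> *s x) \<bullet> e)"
    by (simp add: inner_vec_def inner_complex_def flip: sum_negf)
  ultimately show ?thesis by (simp add: cmod_power2)
qed

lemma inner_matrix_vector_adjoint:
  fixes M :: "complex^'n^'m"
  shows "(M *v x) \<bullet> y = x \<bullet> (conj_transpose M *v y)"
proof -
  have "(\<Sum>i\<in>UNIV. (M *v x) $ i * cnj (y $ i)) =
      (\<Sum>i\<in>UNIV. \<Sum>j\<in>UNIV. M $ i $ j * x $ j * cnj (y $ i))"
    by (simp add: matrix_vector_mult_def sum_distrib_right)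
  also have "\<dots> = (\<Sum>j\<in>UNIV. \<Sum>i\<in>UNIV. M $ i $ j * x $ j * cnj (y $ i))"
    by (rule sum.swap)
  also have "\<dots> = (\<Sum>j\<in>UNIV. x $ j * cnj ((conj_transpose M *v y) $ j))"
    by (simp add: matrix_vector_mult_def conj_transpose_def transpose_def sum_distrib_left mult_ac)
  finally show ?thesis by (simp only: inner_eq_Re_hermitian_product)
qed

lemma norm_isometry:
  fixes W :: "complex^'k^'m"
  assumes "conj_transpose W ** W = mat 1"
  shows "norm (W *v x) = norm x"
  using assms by (simp add: norm_eq_sqrt_inner inner_matrix_vector_adjoint matrix_vector_mul_assoc)

text \<open>
  \<open>W W\<^sup>*\<close> is a projection, which is what \<open>\<parallel>W\<^sup>* y\<parallel>\<^sup>2 = \<langle>W W\<^sup>* y, y\<rangle> \<le> \<parallel>W\<^sup>* y\<parallel> \<parallel>y\<parallel>\<close> expresses.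
\<close>

lemma norm_adjoint_isometry_le:
  fixes W :: "complex^'k^'m"
  assumes "conj_transpose W ** W = mat 1"
  shows "norm (conj_transpose W *v y) \<le> norm y"
proof -
  let ?z = "conj_transpose W *v y"
  have "(norm ?z)\<^sup>2 = (W *v ?z) \<bullet> y"
    by (simp add: power2_norm_eq_inner inner_matrix_vector_adjoint)
  also have "\<dots> \<le> norm (W *v ?z) * norm y" by (rule norm_cauchy_schwarz)
  also have "\<dots> = norm ?z * norm y" by (simp add: norm_isometry[OF assms])
  finally show ?thesis
    by (cases "norm ?z = 0") (auto simp: power2_eq_square)
qed

lemma norm_column_isometry:
  fixes W :: "complex^'k^'m"
  assumes "conj_transpose W ** W = mat 1"
  shows "norm (column j W) = 1"
proof -
  have "W *v axis j 1 = column j W"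
    by (simp add: vec_eq_iff matrix_vector_mult_def axis_def column_def
        if_distrib[where f = "\<lambda>c. _ * c"] cong: if_cong)
  then show ?thesis using norm_isometry[OF assms, of "axis j 1"] by (simp add: norm_axis_1)
qed

lemma norm_matrix_columns:
  fixes M :: "complex^'n^'m"
  shows "(norm M)\<^sup>2 = (\<Sum>j\<in>UNIV. (norm (column j M))\<^sup>2)"
  by (simp add: norm_eq_Frobenius norm_vec_def L2_set_def sum_nonneg column_def)
    (rule sum.swap)

lemma norm_matrix_rows:
  fixes M :: "complex^'n^'m"
  shows "(norm M)\<^sup>2 = (\<Sum>i\<in>UNIV. (norm (row i M))\<^sup>2)"
  by (simp add: norm_eq_Frobenius norm_vec_def L2_set_def sum_nonneg row_def)

lemma column_mult: "column j (P ** Q) = P *v column j Q"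
  by (simp add: vec_eq_iff column_def matrix_matrix_mult_def matrix_vector_mult_def)

lemma norm_isometry_mult:
  fixes W :: "complex^'k^'m" and M :: "complex^'n^'k"
  assumes "conj_transpose W ** W = mat 1"
  shows "norm (W ** M) = norm M"
proof -
  have "(norm (W ** M))\<^sup>2 = (norm M)\<^sup>2"
    by (simp add: norm_matrix_columns column_mult norm_isometry[OF assms])
  then show ?thesis by simp
qed

lemma norm_conj_transpose: "norm (conj_transpose M) = norm M"
proof -
  have "(norm (conj_transpose M))\<^sup>2 = (norm M)\<^sup>2"
    unfolding norm_matrix_rows[of "conj_transpose M"] norm_matrix_columns[of M]
    by (simp add: norm_vec_def L2_set_def row_def column_def conj_transpose_def transpose_def)
  then show ?thesis by simp
qed

lemma conj_transpose_mult: "conj_transpose (P ** Q) = conj_transpose Q ** conj_transpose P"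
  by (simp add: vec_eq_iff conj_transpose_def transpose_def matrix_matrix_mult_def mult.commute)

lemma conj_transpose_involutive: "conj_transpose (conj_transpose M) = M"
  by (simp add: vec_eq_iff conj_transpose_def transpose_def)

lemma diag_matrix_mult_vec: "(diag_matrix idx \<alpha> *v x) $ i = complex_of_real (\<alpha> (idx i)) * x $ i"
  by (simp add: diag_matrix_def matrix_vector_mult_def if_distrib[where f = "\<lambda>c. c * _"] cong: if_cong)

lemma norm_diag_matrix: "(norm (diag_matrix idx \<alpha> :: complex^'k^'k))\<^sup>2 = (\<Sum>j\<in>UNIV. (\<alpha> (idx j))\<^sup>2)"
proof -
  have "(cmod (diag_matrix idx \<alpha> $ i $ j))\<^sup>2 = (if i = j then (\<alpha> (idx i))\<^sup>2 else 0)" for i j :: 'k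
    by (simp add: diag_matrix_def)
  then show ?thesis by (simp add: norm_eq_Frobenius sum_nonneg)
qed

section \<open>Matrices with given singular vectors\<close>

text \<open>
  The diagonal is arbitrary, so that for fixed \<open>U\<close> and \<open>V\<close> the map is linear in \<open>\<alpha>\<close>; this makes
  \<open>F\<close>, its truncation and their linear combinations comparable entry by entry.
\<close>

definition from_svd :: "('k \<Rightarrow> nat) \<Rightarrow> complex^'k^'m \<Rightarrow> (nat \<Rightarrow> real) \<Rightarrow> complex^'k^'n \<Rightarrow> complex^'n^'m"
  where "from_svd idx U \<alpha> V = U ** diag_matrix idx \<alpha> ** conj_transpose V"

lemma from_svd_nth:
  "from_svd idx U \<alpha> V $ r $ c = (\<Sum>j\<in>UNIV. complex_of_real (\<alpha> (idx j)) * (U $ r $ j * cnj (V $ c $ j)))"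
  by (simp add: from_svd_def diag_matrix_def matrix_matrix_mult_def conj_transpose_def transpose_def
      if_distrib[where f = "\<lambda>c. _ * c"] if_distrib[where f = "\<lambda>c. c * _"] mult_ac cong: if_cong)

lemma from_svd_diff: "from_svd idx U \<alpha> V - from_svd idx U \<beta> V = from_svd idx U (\<lambda>j. \<alpha> j - \<beta> j) V"
  by (simp add: vec_eq_iff from_svd_nth left_diff_distrib sum_subtractf)

lemma from_svd_add_scaleR:
  "from_svd idx U \<alpha> V + c *\<^sub>R from_svd idx U \<beta> V = from_svd idx U (\<lambda>j. \<alpha> j + c * \<beta> j) V"
  by (simp add: vec_eq_iff from_svd_nth distrib_right sum.distrib scaleR_sum_right)
    (simp add: scaleR_conv_of_real mult_ac)

lemma norm_from_svd:
  assumes "conj_transpose U ** U = mat 1" "conj_transpose V ** V = mat 1"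
  shows "(norm (from_svd idx U \<alpha> V))\<^sup>2 = (\<Sum>j\<in>UNIV. (\<alpha> (idx j))\<^sup>2)"
proof -
  have "norm (from_svd idx U \<alpha> V) = norm (diag_matrix idx \<alpha> ** conj_transpose V)"
    using assms(1) by (simp add: from_svd_def norm_isometry_mult flip: matrix_mul_assoc)
  also have "\<dots> = norm (V ** conj_transpose (diag_matrix idx \<alpha>))"
    by (subst norm_conj_transpose[symmetric])
       (simp add: conj_transpose_mult conj_transpose_involutive)
  also have "\<dots> = norm (diag_matrix idx \<alpha>)"
    using assms(2) by (simp add: norm_isometry_mult norm_conj_transpose)
  finally show ?thesis by (simp add: norm_diag_matrix)
qed

lemma rank_from_svd_le:
  fixes U :: "complex^'k^'m" and V :: "complex^'k^'n"
  shows "rank (from_svd idx U \<alpha> V) \<le> card {j. \<alpha> (idx j) \<noteq> 0}"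
proof -
  let ?R = "(\<lambda>j. row j (conj_transpose V)) ` {j. \<alpha> (idx j) \<noteq> 0}"
  have "row r (from_svd idx U \<alpha> V) \<in> vec.span ?R" for r
  proof -
    have "row r (from_svd idx U \<alpha> V) =
        (\<Sum>j\<in>UNIV. (complex_of_real (\<alpha> (idx j)) * U $ r $ j) *s row j (conj_transpose V))"
      by (simp add: vec_eq_iff row_def from_svd_nth conj_transpose_def transpose_def mult.assoc)
    moreover have "(complex_of_real (\<alpha> (idx j)) * U $ r $ j) *s row j (conj_transpose V) \<in> vec.span ?R" for j
      by (cases "\<alpha> (idx j) = 0") (auto intro: vec.span_scale[OF vec.span_base] vec.span_zero)
    ultimately show ?thesis by (auto intro: vec.span_sum)
  qed
  then have "vec.dim (rows (from_svd idx U \<alpha> V)) \<le> card ?R"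
    by (intro vec.dim_le_card) (auto simp: rows_def)
  also have "\<dots> \<le> card {j. \<alpha> (idx j) \<noteq> 0}" by (rule card_image_le) simp
  finally show ?thesis by (simp add: row_rank_def_gen)
qed

section \<open>Best approximation by matrices of bounded rank\<close>

text \<open>
  By definition, \<open>rank\<close> is the complex dimension of the row space; a complex basis \<open>B\<close> of that space
  yields the real spanning set \<open>B \<union> \<i> B\<close>, which accounts for the factor 2.
\<close>

lemma rows_in_real_subspace:
  fixes A :: "complex^'n^'m"
  obtains S where "subspace S" "dim S \<le> 2 * rank A"
    "\<And>r. row r A \<in> S" "\<And>r. \<i> *s row r A \<in> S"
proof -
  obtain B where B: "vec.independent B" "rows A \<subseteq> vec.span B" "card B = vec.dim (rows A)"
    using vec.basis_exists by blast
  have finB: "finite B" using B(1) by (rule vec.finiteI_independent)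
  define S where "S = span (B \<union> (\<lambda>x. \<i> *s x) ` B)"
  have lin: "\<i> *s x \<in> S" if "x \<in> S" for x
    using that unfolding S_def
  proof (induction rule: span_induct_alt)
    case base
    then show ?case by (simp add: span_zero)
  next
    case (step c x y)
    have "\<i> *s x \<in> span (B \<union> (\<lambda>x. \<i> *s x) ` B)"
    proof (cases "x \<in> B")
      case True
      then show ?thesis by (auto intro: span_base)
    next
      case False
      then obtain b where "b \<in> B" "x = \<i> *s b" using step by auto
      then have "\<i> *s x = - b" by (simp add: vec_eq_iff)
      then show ?thesis using \<open>b \<in> B\<close> by (auto intro: span_neg span_base)
    qed
    moreover have "\<i> *s (c *\<^sub>R x + y) = c *\<^sub>R (\<i> *s x) + \<i> *s y"
      by (simp add: vec_eq_iff algebra_simps)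
    ultimately show ?case using step by (auto intro: span_add span_scale)
  qed
  have sub: "subspace S" by (simp add: S_def)
  have "c *s x \<in> S" if "x \<in> S" for c x
  proof -
    have "c *s x = Re c *\<^sub>R x + Im c *\<^sub>R (\<i> *s x)"
      by (simp add: vec_eq_iff complex_eq_iff)
    then show ?thesis using that lin sub by (auto intro: subspace_add subspace_scale)
  qed
  then have "vec.subspace S"
    using sub by (auto simp: vec.subspace_def subspace_0 subspace_add)
  then have "vec.span B \<subseteq> S"
    by (intro vec.span_minimal) (auto simp: S_def intro: span_base)
  then have rowsS: "row r A \<in> S" for r using B(2) by (auto simp: rows_def)
  have "dim S \<le> card (B \<union> (\<lambda>x. \<i> *s x) ` B)"
    unfolding S_def using finB by (intro dim_le_card) auto
  also have "\<dots> \<le> card B + card ((\<lambda>x. \<i> *s x) ` B)" by (rule card_Un_le)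
  also have "\<dots> \<le> 2 * card B" using card_image_le[OF finB, of "\<lambda>x. \<i> *s x"] by simp
  finally have "dim S \<le> 2 * rank A" by (simp add: B(3) row_rank_def_gen)
  then show ?thesis using that[OF sub] rowsS lin by blast
qed

text \<open>
  The bathtub principle: with weights capped at \<open>b\<close> and total weight at most \<open>b\<close> times
  the size of \<open>J\<close>, the weighted sum is largest when all the weight is on the indices where \<open>g\<close> is
  largest.  Subtracting the threshold \<open>c\<close> from \<open>g\<close> makes every term favour that choice.
\<close>

lemma weighted_sum_le_top:
  fixes g w :: "'k::finite \<Rightarrow> real"
  assumes w: "\<And>j. 0 \<le> w j" "\<And>j. w j \<le> b" and tot: "sum w UNIV \<le> b * card J" and "0 \<le> c"
    and top: "\<And>j. j \<in> J \<Longrightarrow> c \<le> g j" and rest: "\<And>j. j \<notin> J \<Longrightarrow> g j \<le> c"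
  shows "(\<Sum>j\<in>UNIV. g j * w j) \<le> b * sum g J"
proof -
  have "(\<Sum>j\<in>UNIV. (g j - c) * w j) \<le> (\<Sum>j\<in>UNIV. if j \<in> J then (g j - c) * b else 0)"
    using w top rest by (intro sum_mono) (auto intro: mult_left_mono mult_nonpos_nonneg)
  also have "\<dots> = b * sum g J - c * (b * card J)"
    by (simp add: sum.If_cases left_diff_distrib sum_subtractf sum_distrib_left algebra_simps)
  finally have "(\<Sum>j\<in>UNIV. g j * w j) - c * sum w UNIV \<le> b * sum g J - c * (b * card J)"
    by (simp add: left_diff_distrib sum_subtractf sum_distrib_left)
  moreover have "c * sum w UNIV \<le> c * (b * card J)" using tot \<open>0 \<le> c\<close> by (rule mult_left_mono)
  ultimately show ?thesis by linarith
qed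

text \<open>
  In the proof, \<open>E\<close> is a real orthonormal basis of the row space of \<open>A\<close>, seen as a
  real space, and \<open>w j\<close> is twice the fraction of \<open>\<gamma>\<^sub>j\<^sup>2\<close> that the projection onto this
  space captures: the squared hermitian products of \<open>E\<close> with the right singular vector \<open>v\<^sub>j\<close>.
  Bessel's inequality for \<open>v\<^sub>j\<close> and \<open>\<i> v\<^sub>j\<close> caps \<open>w j\<close> at 2, and Bessel's inequality for the \<open>v\<^sub>j\<close>
  caps the total at the number of elements of \<open>E\<close>.
\<close>

lemma Eckart_Young:
  fixes U :: "complex^'k^'m" and V :: "complex^'k^'n" and A :: "complex^'n^'m"
  assumes U: "conj_transpose U ** U = mat 1" and V: "conj_transpose V ** V = mat 1"
    and rank: "rank A \<le> card {j. idx j \<in> J}"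
    and "0 \<le> c"
    and top: "\<And>j. idx j \<in> J \<Longrightarrow> c \<le> (\<gamma> (idx j))\<^sup>2"
    and rest: "\<And>j. idx j \<notin> J \<Longrightarrow> (\<gamma> (idx j))\<^sup>2 \<le> c"
  shows "norm (from_svd idx U (\<lambda>j. if j \<in> J then \<gamma> j else 0) V - from_svd idx U \<gamma> V)
    \<le> norm (A - from_svd idx U \<gamma> V)"
proof -
  define G where "G = from_svd idx U \<gamma> V"
  obtain S where S: "subspace S" "dim S \<le> 2 * rank A" "\<And>r. row r A \<in> S" "\<And>r. \<i> *s row r A \<in> S"
    using rows_in_real_subspace by blast
  obtain E where E: "pairwise orthogonal E" "\<And>e. e \<in> E \<Longrightarrow> norm e = 1"
      "independent E" "card E = dim S" "span E = S"
    using orthonormal_basis_subspace[OF S(1)] by metis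
  have finE: "finite E" using E(3) by (rule independent_imp_finite)
  \<comment> \<open>Matrix times vector pairs rows with \<open>e\<close> bilinearly; conjugating \<open>e\<close> makes the pairing hermitian.\<close>
  define ebar :: "complex^'n \<Rightarrow> complex^'n" where "ebar e = (\<chi> i. cnj (e $ i))" for e
  have ebar1: "norm (ebar e) = norm e" for e by (simp add: ebar_def norm_vec_def)
  define w where "w j = (\<Sum>e\<in>E. (cmod ((conj_transpose V *v ebar e) $ j))\<^sup>2)" for j
  have w2: "w j \<le> 2" for j
  proof -
    let ?v = "ebar (column j V)"
    have "(conj_transpose V *v ebar e) $ j = (\<Sum>i\<in>UNIV. ?v $ i * cnj (e $ i))" for e
      by (simp add: conj_transpose_def transpose_def matrix_vector_mult_def ebar_def column_def)
    then have "w j = (\<Sum>e\<in>E. (?v \<bullet> e)\<^sup>2) + (\<Sum>e\<in>E. ((\<i> *s ?v) \<bullet> e)\<^sup>2)"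
      by (simp add: w_def cmod_hermitian_product sum.distrib)
    also have "\<dots> \<le> (norm ?v)\<^sup>2 + (norm (\<i> *s ?v))\<^sup>2"
      by (intro add_mono Bessel_inequality finE E)
    also have "\<dots> = 2" by (simp add: norm_imaginary_smult ebar1 norm_column_isometry[OF V])
    finally show ?thesis .
  qed
  have "sum w UNIV = (\<Sum>e\<in>E. (norm (conj_transpose V *v ebar e))\<^sup>2)"
    unfolding w_def by (subst sum.swap) (simp add: norm_vec_def L2_set_def sum_nonneg)
  also have "\<dots> \<le> (\<Sum>e\<in>E. 1)"
  proof (rule sum_mono)
    fix e assume "e \<in> E"
    then have "norm (conj_transpose V *v ebar e) \<le> 1"
      using norm_adjoint_isometry_le[OF V, of "ebar e"] by (simp add: ebar1 E(2))
    then show "(norm (conj_transpose V *v ebar e))\<^sup>2 \<le> 1" by (simp add: power_le_one)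
  qed
  also have "\<dots> \<le> 2 * card {j. idx j \<in> J}" using S(2) rank by (simp add: E(4))
  finally have wsum: "sum w UNIV \<le> 2 * card {j. idx j \<in> J}" .
  \<comment> \<open>The norm of the projected rows of \<open>G\<close> and \<open>\<i> G\<close>, expressed through \<open>w\<close>\<close>
  have "(\<Sum>r\<in>UNIV. \<Sum>e\<in>E. (row r G \<bullet> e)\<^sup>2 + ((\<i> *s row r G) \<bullet> e)\<^sup>2)
      = (\<Sum>e\<in>E. (norm (G *v ebar e))\<^sup>2)"
    by (subst sum.swap)
      (simp add: norm_vec_def L2_set_def sum_nonneg matrix_vector_mult_def ebar_def row_def
        flip: cmod_hermitian_product)
  also have "\<dots> = (\<Sum>e\<in>E. \<Sum>j\<in>UNIV. (\<gamma> (idx j))\<^sup>2 * (cmod ((conj_transpose V *v ebar e) $ j))\<^sup>2)"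
  proof (rule sum.cong[OF refl])
    fix e
    have "G *v ebar e = U *v (diag_matrix idx \<gamma> *v (conj_transpose V *v ebar e))"
      by (simp add: G_def from_svd_def matrix_vector_mul_assoc matrix_mul_assoc)
    then have "norm (G *v ebar e) = norm (diag_matrix idx \<gamma> *v (conj_transpose V *v ebar e))"
      by (simp add: norm_isometry[OF U])
    then show "(norm (G *v ebar e))\<^sup>2 = (\<Sum>j\<in>UNIV. (\<gamma> (idx j))\<^sup>2 * (cmod ((conj_transpose V *v ebar e) $ j))\<^sup>2)"
      by (simp add: norm_vec_def L2_set_def sum_nonneg diag_matrix_mult_vec norm_mult power_mult_distrib)
  qed
  also have "\<dots> = (\<Sum>j\<in>UNIV. (\<gamma> (idx j))\<^sup>2 * w j)"
    unfolding w_def by (subst sum.swap) (simp add: sum_distrib_left)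
  also have "\<dots> \<le> 2 * (\<Sum>j\<in>{j. idx j \<in> J}. (\<gamma> (idx j))\<^sup>2)"
    using wsum w2 \<open>0 \<le> c\<close> top rest
    by (intro weighted_sum_le_top[where c = c]) (auto simp: w_def sum_nonneg)
  finally have captured: "(\<Sum>r\<in>UNIV. \<Sum>e\<in>E. (row r G \<bullet> e)\<^sup>2 + ((\<i> *s row r G) \<bullet> e)\<^sup>2)
      \<le> 2 * (\<Sum>j\<in>{j. idx j \<in> J}. (\<gamma> (idx j))\<^sup>2)" .
  \<comment> \<open>The rows of \<open>A\<close> lie in the span of \<open>E\<close>, so they miss whatever the projection misses.\<close>
  have "2 * (norm (row r G))\<^sup>2 - (\<Sum>e\<in>E. (row r G \<bullet> e)\<^sup>2 + ((\<i> *s row r G) \<bullet> e)\<^sup>2)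
      \<le> 2 * (norm (row r (A - G)))\<^sup>2" for r
  proof -
    have 1: "(norm (row r G))\<^sup>2 - (\<Sum>e\<in>E. (row r G \<bullet> e)\<^sup>2) \<le> (norm (row r A - row r G))\<^sup>2"
      by (rule norm_diff_span_ge) (use finE E S in auto)
    have 2: "(norm (\<i> *s row r G))\<^sup>2 - (\<Sum>e\<in>E. ((\<i> *s row r G) \<bullet> e)\<^sup>2)
        \<le> (norm (\<i> *s row r A - \<i> *s row r G))\<^sup>2"
      by (rule norm_diff_span_ge) (use finE E S in auto)
    have "row r (A - G) = row r A - row r G" by (simp add: row_def vec_eq_iff)
    moreover have "\<i> *s row r A - \<i> *s row r G = \<i> *s (row r A - row r G)"
      by (simp add: vec_eq_iff algebra_simps)
    ultimately show ?thesis using 1 2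
      by (simp only: norm_imaginary_smult sum.distrib)
  qed
  then have "2 * (norm G)\<^sup>2 - (\<Sum>r\<in>UNIV. \<Sum>e\<in>E. (row r G \<bullet> e)\<^sup>2 + ((\<i> *s row r G) \<bullet> e)\<^sup>2)
      \<le> 2 * (norm (A - G))\<^sup>2"
    unfolding norm_matrix_rows sum_distrib_left sum_subtractf[symmetric] by (intro sum_mono)
  with captured have "(norm G)\<^sup>2 - (\<Sum>j\<in>{j. idx j \<in> J}. (\<gamma> (idx j))\<^sup>2) \<le> (norm (A - G))\<^sup>2"
    by linarith
  moreover have "(norm (from_svd idx U (\<lambda>j. if j \<in> J then \<gamma> j else 0) V - G))\<^sup>2
      = (norm G)\<^sup>2 - (\<Sum>j\<in>{j. idx j \<in> J}. (\<gamma> (idx j))\<^sup>2)"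
  proof -
    have "(\<Sum>j\<in>UNIV. ((if idx j \<in> J then \<gamma> (idx j) else 0) - \<gamma> (idx j))\<^sup>2)
        = (\<Sum>j\<in>UNIV. (\<gamma> (idx j))\<^sup>2 - (if idx j \<in> J then (\<gamma> (idx j))\<^sup>2 else 0))"
      by (rule sum.cong) auto
    then show ?thesis
      by (simp add: G_def from_svd_diff norm_from_svd[OF U V] sum_subtractf sum.If_cases)
  qed
  ultimately have "(norm (from_svd idx U (\<lambda>j. if j \<in> J then \<gamma> j else 0) V - G))\<^sup>2 \<le> (norm (A - G))\<^sup>2"
    by simp
  then show ?thesis unfolding G_def by (rule power2_le_imp_le) simp
qed

section \<open>Minimising a convex envelope plus a quadratic\<close>

lemma convex_ereal_affine: "convex_ereal (\<lambda>x::'a::real_inner. ereal (a + b \<bullet> (x - y)))"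
proof -
  have "a + b \<bullet> ((u *\<^sub>R x1 + v *\<^sub>R x2) - y) \<le> u * r1 + v * r2"
    if "a + b \<bullet> (x1 - y) \<le> r1" "a + b \<bullet> (x2 - y) \<le> r2" "0 \<le> u" "0 \<le> v" "u + v = 1"
    for x1 x2 r1 r2 u v
  proof -
    have "a + b \<bullet> ((u *\<^sub>R x1 + v *\<^sub>R x2) - y)
        = (u + v) * a + (u * (b \<bullet> x1) + v * (b \<bullet> x2) - (u + v) * (b \<bullet> y))"
      using that(5) by (simp add: inner_diff_right inner_add_right)
    also have "\<dots> = u * (a + b \<bullet> (x1 - y)) + v * (a + b \<bullet> (x2 - y))"
      by (simp add: inner_diff_right algebra_simps)
    also have "\<dots> \<le> u * r1 + v * r2" using that by (intro add_mono mult_left_mono)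
    finally show ?thesis .
  qed
  then show ?thesis unfolding convex_ereal_def by (intro convexI) auto
qed

text \<open>
  The slope \<open>2 \<rho> (F - A0)\<close> is the one that cancels the linear term of the quadratic around
  \<open>A0\<close>.  What remains of the objective is at least its value at \<open>A0\<close> plus \<open>\<rho> \<parallel>A - A0\<parallel>\<^sup>2\<close>, which also
  excludes any other minimiser.
\<close>

lemma argmin_envelope_plus_quadratic:
  fixes f :: "'a::real_inner \<Rightarrow> ereal"
  assumes "\<rho> > 0" and f0: "f A0 = ereal a"
    and minorant: "\<And>A. ereal (a + (2 * \<rho>) * ((F - A0) \<bullet> (A - A0))) \<le> f A"
  shows "{A. is_arg_min (\<lambda>A. convex_envelope f A + ereal (\<rho> * (norm (A - F))\<^sup>2)) (\<lambda>_. True) A} = {A0}"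
proof -
  let ?h = "\<lambda>A. convex_envelope f A + ereal (\<rho> * (norm (A - F))\<^sup>2)"
  have env: "ereal (a + ((2 * \<rho>) *\<^sub>R (F - A0)) \<bullet> (A - A0)) \<le> convex_envelope f A" for A
    by (rule convex_envelope_greatest[OF convex_ereal_affine]) (use minorant in simp)
  have lower: "ereal (a + \<rho> * (norm (A0 - F))\<^sup>2 + \<rho> * (norm (A - A0))\<^sup>2) \<le> ?h A" for A
  proof -
    have "(norm (A - F))\<^sup>2 = (norm ((A - A0) - (F - A0)))\<^sup>2" by simp
    also have "\<dots> = (norm (A - A0))\<^sup>2 - 2 * ((F - A0) \<bullet> (A - A0)) + (norm (A0 - F))\<^sup>2"
      by (simp add: power2_norm_eq_inner inner_diff_left inner_diff_right inner_commute)
    finally have split: "(norm (A - F))\<^sup>2 = \<dots>" .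
    have "a + \<rho> * (norm (A0 - F))\<^sup>2 + \<rho> * (norm (A - A0))\<^sup>2
        = (a + ((2 * \<rho>) *\<^sub>R (F - A0)) \<bullet> (A - A0)) + \<rho> * (norm (A - F))\<^sup>2"
      unfolding split inner_scaleR_left by (simp only: distrib_left right_diff_distrib)
    then show ?thesis
      using add_right_mono[OF env[of A], of "ereal (\<rho> * (norm (A - F))\<^sup>2)"] by (simp only: plus_ereal.simps(1))
  qed
  have upper: "?h A0 \<le> ereal (a + \<rho> * (norm (A0 - F))\<^sup>2)"
    using convex_envelope_le[of f A0] by (simp add: f0 add_right_mono flip: plus_ereal.simps(1))
  have strict: "?h A0 < ?h A" if "A \<noteq> A0" for A
  proof -
    have "?h A0 \<le> ereal (a + \<rho> * (norm (A0 - F))\<^sup>2)" by (rule upper)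
    also have "\<dots> < ereal (a + \<rho> * (norm (A0 - F))\<^sup>2 + \<rho> * (norm (A - A0))\<^sup>2)"
      using that \<open>\<rho> > 0\<close> by simp
    also have "\<dots> \<le> ?h A" by (rule lower)
    finally show ?thesis .
  qed
  have "is_arg_min ?h (\<lambda>_. True) A \<longleftrightarrow> A = A0" for A
    unfolding is_arg_min_def using strict by (metis less_asym less_irrefl)
  then show ?thesis by blast
qed

section \<open>The minimiser\<close>

theorem mainTheorem4:
  fixes F :: "complex^'n^'m"
    and U :: "complex^'k^'m"
    and V :: "complex^'k^'n"
    and idx :: "'k \<Rightarrow> nat"
    and \<phi> :: "nat \<Rightarrow> real"
    and K N :: nat
    and \<rho> :: real
  assumes "N = min CARD('m) CARD('n)"
    and "1 \<le> K" and "K < N"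
    and "\<rho> > 0"
    and "is_svd idx F U \<phi> V"
    and "\<phi> K \<ge> (1 + \<rho>) * \<phi> (K + 1)"
  shows "{A. is_arg_min
            (\<lambda>A. convex_envelope (penalized_fit K F) A + ereal (\<rho> * (norm (A - F))\<^sup>2))
            (\<lambda>_. True) A}
       = {U ** diag_matrix idx (\<lambda>j. if j \<le> K then \<phi> j else 0) ** conj_transpose V}"
proof -
  have bij: "bij_betw idx (UNIV :: 'k set) {1..N}"
    and U: "conj_transpose U ** U = mat 1" and V: "conj_transpose V ** V = mat 1"
    and mono: "\<And>i j. i \<in> {1..N} \<Longrightarrow> j \<in> {1..N} \<Longrightarrow> i \<le> j \<Longrightarrow> \<phi> j \<le> \<phi> i"
    and nonneg: "\<And>j. j \<in> {1..N} \<Longrightarrow> 0 \<le> \<phi> j"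
    and F: "F = from_svd idx U \<phi> V"
    using assms(5) unfolding is_svd_def from_svd_def assms(1) Let_def by blast+
  have idx_range: "idx j \<in> {1..N}" for j using bij by (auto simp: bij_betw_def)
  define \<phi>K where "\<phi>K = (\<lambda>j. if j \<in> {..K} then \<phi> j else 0)"
  define A0 where "A0 = from_svd idx U \<phi>K V"
  \<comment> \<open>the diagonal of \<open>G = F + \<rho> (F - A0)\<close>: \<open>\<phi> j\<close> up to \<open>K\<close> and \<open>(1 + \<rho>) * \<phi> j\<close> beyond\<close>
  define \<gamma> where "\<gamma> = (\<lambda>j. \<phi> j + \<rho> * (\<phi> j - \<phi>K j))"
  have "idx ` {j. idx j \<in> {..K}} = {1..K}"
  proof -
    have "idx ` {j. idx j \<in> {..K}} = range idx \<inter> {..K}" by auto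
    also have "\<dots> = {1..K}" using bij \<open>K < N\<close> by (auto simp: bij_betw_def)
    finally show ?thesis .
  qed
  then have cardK: "card {j. idx j \<in> {..K}} = K"
    using bij card_image[of idx "{j. idx j \<in> {..K}}"] by (auto simp: bij_betw_def inj_on_def)
  have rankA0: "rank A0 \<le> K"
  proof -
    have "rank A0 \<le> card {j. \<phi>K (idx j) \<noteq> 0}" unfolding A0_def by (rule rank_from_svd_le)
    also have "\<dots> \<le> card {j. idx j \<in> {..K}}" by (rule card_mono) (auto simp: \<phi>K_def)
    finally show ?thesis by (simp only: cardK)
  qed
  have G: "from_svd idx U \<gamma> V = F + \<rho> *\<^sub>R (F - A0)"
    by (simp add: F A0_def from_svd_diff from_svd_add_scaleR \<gamma>_def)
  have A0_trunc: "A0 = from_svd idx U (\<lambda>j. if j \<in> {..K} then \<gamma> j else 0) V"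
    unfolding A0_def by (rule arg_cong[where f = "\<lambda>\<alpha>. from_svd idx U \<alpha> V"]) (auto simp: \<gamma>_def \<phi>K_def)
  have best: "norm (A0 - (F + \<rho> *\<^sub>R (F - A0))) \<le> norm (A - (F + \<rho> *\<^sub>R (F - A0)))"
    if "rank A \<le> K" for A
  proof -
    have "(\<phi> K)\<^sup>2 \<le> (\<gamma> (idx j))\<^sup>2" if "idx j \<in> {..K}" for j
      using that mono[of "idx j" K] nonneg[of K] idx_range[of j] assms(2,3)
      by (auto simp: \<gamma>_def \<phi>K_def intro!: power_mono)
    moreover have "(\<gamma> (idx j))\<^sup>2 \<le> (\<phi> K)\<^sup>2" if "idx j \<notin> {..K}" for j
    proof -
      have "\<phi> (idx j) \<le> \<phi> (K + 1)" using that idx_range[of j] \<open>K < N\<close> by (intro mono) auto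
      then have "(1 + \<rho>) * \<phi> (idx j) \<le> \<phi> K"
        using assms(4,6) by (meson add_pos_pos less_eq_real_def mult_left_mono order_trans zero_less_one)
      moreover have "\<gamma> (idx j) = (1 + \<rho>) * \<phi> (idx j)"
        using that by (simp add: \<gamma>_def \<phi>K_def algebra_simps)
      ultimately show ?thesis using nonneg[OF idx_range[of j]] \<open>\<rho> > 0\<close> by (auto intro!: power_mono)
    qed
    ultimately show ?thesis
      using Eckart_Young[OF U V, of A idx "{..K}" "(\<phi> K)\<^sup>2" \<gamma>] that
      by (simp only: cardK A0_trunc[symmetric] G[symmetric]) auto
  qed
  have "{A. is_arg_min
            (\<lambda>A. convex_envelope (penalized_fit K F) A + ereal (\<rho> * (norm (A - F))\<^sup>2))
            (\<lambda>_. True) A} = {A0}"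
  proof (rule argmin_envelope_plus_quadratic[OF \<open>\<rho> > 0\<close>])
    show "penalized_fit K F A0 = ereal ((norm (A0 - F))\<^sup>2)"
      using rankA0 by (simp add: penalized_fit_def rank_penalty_def)
    fix A
    show "ereal ((norm (A0 - F))\<^sup>2 + 2 * \<rho> * ((F - A0) \<bullet> (A - A0))) \<le> penalized_fit K F A"
    proof (cases "rank A \<le> K")
      case True
      \<comment> \<open>For \<open>B = A\<close> and \<open>B = A0\<close> the last term is the same and drops out of the comparison.\<close>
      have expand: "(norm (B - (F + \<rho> *\<^sub>R (F - A0))))\<^sup>2
          = (norm (B - F))\<^sup>2 - 2 * \<rho> * ((F - A0) \<bullet> (B - F)) + \<rho>\<^sup>2 * (norm (F - A0))\<^sup>2" for B
      proof -
        have eq: "B - (F + \<rho> *\<^sub>R (F - A0)) = (B - F) - \<rho> *\<^sub>R (F - A0)" by simp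
        show ?thesis unfolding eq
          using dot_norm_neg[of "B - F" "\<rho> *\<^sub>R (F - A0)"] by (simp add: inner_commute power_mult_distrib)
      qed
      have "(norm (A0 - (F + \<rho> *\<^sub>R (F - A0))))\<^sup>2 \<le> (norm (A - (F + \<rho> *\<^sub>R (F - A0))))\<^sup>2"
        using best[OF True] by (simp add: power_mono)
      moreover have "(F - A0) \<bullet> (A - A0) = (F - A0) \<bullet> (A - F) - (F - A0) \<bullet> (A0 - F)"
        by (simp add: inner_diff_right)
      ultimately have "(norm (A0 - F))\<^sup>2 + 2 * \<rho> * ((F - A0) \<bullet> (A - A0)) \<le> (norm (A - F))\<^sup>2"
        unfolding expand by (simp add: right_diff_distrib)
      then show ?thesis using True by (simp add: penalized_fit_def rank_penalty_def)
    qed (simp add: penalized_fit_def rank_penalty_def)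
  qed
  also have "A0 = U ** diag_matrix idx (\<lambda>j. if j \<le> K then \<phi> j else 0) ** conj_transpose V"
    by (simp add: A0_def \<phi>K_def from_svd_def)
  finally show ?thesis .
qed

end
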